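(* Let $m$ be a positive integer and let $p$ be a prime with $p\equiv 1\pmod{2m}$. Suppose that $2$ is an $m$th power residue modulo $p$. Then for any integer $a$ with $a\not\equiv 0\pmod p$, $$\prod_{k\in R_m(p)}\left(1+\tan\frac{\pi a k}{p}\right)=\left(\frac{-2}{p}\right)_{2m}(-2)^{(p-1)/(2m)}.$$
   Context: For a positive integer $m$ and a prime $p\equiv 1\pmod m$, an integer $b\not\equiv 0\pmod p$ is an $m$th power residue modulo $p$ if $x^m\equiv b\pmod p$ for some integer $x$, and $R_m(p)=\{k\in\{1,\ldots,p-1\}:\ k \text{ is an } m\text{th power residue modulo } p\}$. For a positive integer $n$ with $p\equiv1\pmod n$ and an integer $b\not\equiv0\pmod p$, the $n$th power residue symbol $\left(\frac{b}{p}\right)_n$ is the unique $n$th root of unity $\zeta$ such that $b^{(p-1)/n}\equiv\zeta\pmod p$ in the ring of all algebraic integers. *)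

theory Defs
  imports "HOL-Analysis.Analysis" "HOL-Number_Theory.Number_Theory"
begin

definition power_residue :: "nat \<Rightarrow> nat \<Rightarrow> int \<Rightarrow> bool" where
  "power_residue m p b \<longleftrightarrow> \<not> [b = 0] (mod int p) \<and> (\<exists>x::int. [x ^ m = b] (mod int p))"

definition power_residues :: "nat \<Rightarrow> nat \<Rightarrow> nat set" where
  "power_residues m p = {k \<in> {1..p - 1}. power_residue m p (int k)}"

(* x and y congruent modulo d in the ring of all algebraic integers, as a subring of the complex
   numbers. *)
definition alg_int_cong :: "complex \<Rightarrow> complex \<Rightarrow> complex \<Rightarrow> bool" where
  "alg_int_cong x y d \<longleftrightarrow> (\<exists>c. algebraic_int c \<and> x - y = d * c)"

(* For general b an n-th root of unity with this property need not exist, since the modulus is p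
   itself and not a prime ideal above p; the value is then unspecified. When p is odd
   and b is an (n/2)-th power residue (n even, n dividing p - 1), b ^ ((p - 1) div n) is 1 or -1 modulo p, and the symbol
   is that sign. *)
definition power_residue_symbol :: "nat \<Rightarrow> nat \<Rightarrow> int \<Rightarrow> complex" where
  "power_residue_symbol n p b =
     (THE \<zeta>. \<zeta> ^ n = 1 \<and> alg_int_cong (of_int (b ^ ((p - 1) div n))) \<zeta> (of_nat p))"

end

theory Submission
  imports Defs "Jordan_Normal_Form.Char_Poly"
begin

text \<open>
  Write \<open>R\<close> for the group of \<open>m\<close>-th power residues, of order \<open>2 h = (p - 1) / m\<close>, and
  \<open>z = exp (2 \<pi> i a / p)\<close>. Then \<open>1 + tan (\<pi> a k / p) = (1 - i) (z^k + i) / (1 + z^k)\<close>.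
  Since \<open>2 R = R\<close>, the product of the \<open>1 + z^k = (1 - z^(2 k)) / (1 - z^k)\<close> is \<open>1\<close>, so is that
  of the \<open>(z^k + i) (z^k - i)\<close>; with \<open>- R = R\<close> this gives \<open>L^2 = 2^(2 h)\<close> for the product \<open>L\<close>
  in question. Hence \<open>L = s (-2)^h\<close> for a sign \<open>s\<close>. Modulo \<open>p\<close> in the algebraic integers,
  \<open>L^p\<close> is the product of the \<open>(1 + (-i)^p) (1 + i^p) = 2\<close>, that is \<open>2^(2 h)\<close>, which is \<open>1\<close>;
  so \<open>L\<close> is \<open>1\<close> modulo \<open>p\<close> and \<open>s\<close> is congruent to \<open>(-2)^h\<close>, i.e. \<open>s\<close> is the residue symbol.
  The symbol is well defined because \<open>1 - w\<close> divides \<open>2 m < p\<close> for every \<open>(2 m)\<close>-th root of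
  unity \<open>w \<noteq> 1\<close>.
\<close>

section \<open>The ring of algebraic integers\<close>

text \<open>Makes \<open>int_module.span S\<close> the additive group generated by \<open>S\<close>;
  integrality is tested through such finitely generated groups.\<close>

interpretation int_module: Modules.module "\<lambda>(k::int) (x::'a::field_char_0). of_int k * x"
  by unfold_locales (simp_all add: algebra_simps)

lemma algebraic_int_if_stable_span:
  fixes x :: "'a::field_char_0"
  assumes "finite S" "v0 \<in> S" "v0 \<noteq> 0"
    and stable: "\<And>v. v \<in> S \<Longrightarrow> x * v \<in> int_module.span S"
  shows "algebraic_int x"
  \<comment> \<open>\<open>x\<close> is an eigenvalue of an integer matrix, hence a root of its characteristic polynomial.\<close>
proof -
  obtain f where f: "bij_betw f {0..<card S} S"
    using ex_bij_betw_nat_finite[OF \<open>finite S\<close>] by blast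
  define n where "n = card S"
  have "\<exists>c. x * v = (\<Sum>w\<in>S. of_int (c w) * w)" if "v \<in> S" for v
    using stable[OF that] \<open>finite S\<close> by (auto simp: int_module.span_finite)
  then obtain c where c: "\<And>v. v \<in> S \<Longrightarrow> x * v = (\<Sum>w\<in>S. of_int (c v w) * w)"
    by metis
  define A :: "int mat" where "A = Matrix.mat n n (\<lambda>(i, j). c (f i) (f j))"
  define B :: "'a mat" where "B = map_mat of_int A"
  define v where "v = Matrix.vec n f"
  have A: "A \<in> carrier_mat n n" and B: "B \<in> carrier_mat n n"
    by (simp_all add: A_def B_def)
  have fS: "f i \<in> S" if "i < n" for i
    using f that by (auto simp: bij_betw_def n_def)
  have "B *\<^sub>v v = x \<cdot>\<^sub>v v"
  proof (rule eq_vecI)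
    fix i assume "i < dim_vec (x \<cdot>\<^sub>v v)"
    hence i: "i < n" by (simp add: v_def)
    have "(B *\<^sub>v v) $ i = (\<Sum>j\<in>{0..<n}. of_int (c (f i) (f j)) * f j)"
      using i by (simp add: A_def B_def v_def scalar_prod_def)
    also have "\<dots> = (\<Sum>w\<in>S. of_int (c (f i) w) * w)"
      unfolding n_def by (rule sum.reindex_bij_betw[OF f])
    also have "\<dots> = x * f i" using c[OF fS[OF i]] by simp
    finally show "(B *\<^sub>v v) $ i = (x \<cdot>\<^sub>v v) $ i" using i by (simp add: v_def)
  qed (simp add: A_def B_def v_def)
  \<comment> \<open>The entries of \<open>v\<close> enumerate \<open>S\<close>, so the nonzero
    element \<open>v0\<close> is one of them.\<close>
  moreover have "v \<noteq> 0\<^sub>v n"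
  proof -
    obtain i where "i < n" "f i = v0"
      using f \<open>v0 \<in> S\<close> unfolding bij_betw_def n_def by (metis atLeastLessThan_iff imageE)
    thus ?thesis using \<open>v0 \<noteq> 0\<close> by (auto simp: v_def vec_eq_iff)
  qed
  ultimately have "eigenvalue B x"
    unfolding eigenvalue_def eigenvector_def using B by (intro exI[of _ v]) (auto simp: v_def)
  hence "poly (map_poly of_int (char_poly A)) x = 0"
    using eigenvalue_root_char_poly[OF B] by (simp add: B_def of_int_hom.char_poly_hom[OF A])
  moreover have "lead_coeff (char_poly A) = 1"
    using degree_monic_char_poly[OF A] by auto
  ultimately show ?thesis by (auto simp: algebraic_int_altdef_ipoly)
qed

text \<open>A monic integer equation of degree \<open>d\<close> is solved for its leading power. A
  monic constant is 1 and has no root, so \<open>d > 0\<close>; this later puts 1 among the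
  generators.\<close>

lemma algebraic_int_power_in_span:
  fixes x :: "'a::field_char_0"
  assumes "algebraic_int x"
  obtains d where "d > 0" "x ^ d \<in> int_module.span ((\<lambda>i. x ^ i) ` {..<d})"
proof -
  obtain q where q: "poly (map_poly of_int q) x = 0" "lead_coeff q = 1"
    using assms by (auto simp: algebraic_int_altdef_ipoly)
  define d where "d = degree q"
  have "d > 0"
  proof (rule ccontr)
    assume "\<not> d > 0"
    then obtain c where "q = [:c:]" by (auto simp: d_def elim: degree_eq_zeroE)
    with q show False by auto
  qed
  have "0 = (\<Sum>i\<le>d. of_int (Polynomial.coeff q i) * x ^ i)"
    using q(1) by (simp add: poly_altdef d_def)
  also have "\<dots> = x ^ d + (\<Sum>i<d. of_int (Polynomial.coeff q i) * x ^ i)"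
    using q(2) by (simp add: d_def lessThan_Suc_atMost[symmetric])
  finally have "x ^ d = - (\<Sum>i<d. of_int (Polynomial.coeff q i) * x ^ i)"
    by (simp add: eq_neg_iff_add_eq_0)
  also have "\<dots> \<in> int_module.span ((\<lambda>i. x ^ i) ` {..<d})"
    by (intro int_module.span_neg int_module.span_sum int_module.span_scale int_module.span_base) auto
  finally show ?thesis using \<open>d > 0\<close> that by blast
qed

text \<open>Multiplication by \<open>y\<close> is additive and commutes with integer scalars, so
  checking the generators is enough.\<close>

lemma span_mult_right:
  fixes x y :: "'a::field_char_0"
  assumes "x \<in> int_module.span S" "\<And>s. s \<in> S \<Longrightarrow> s * y \<in> int_module.span T"
  shows "x * y \<in> int_module.span T"
  using assms(1)
proof (induction rule: int_module.span_induct_alt)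
  case base
  show ?case by (simp add: int_module.span_zero)
next
  case (step c s z)
  have "(of_int c * s + z) * y = of_int c * (s * y) + z * y" by (simp add: algebra_simps)
  thus ?case using assms(2)[OF step(1)] step(2)
    by (auto intro: int_module.span_add int_module.span_scale)
qed

lemma
  fixes x y :: "'a::field_char_0"
  assumes "algebraic_int x" "algebraic_int y"
  shows algebraic_int_plus: "algebraic_int (x + y)"
    and algebraic_int_times: "algebraic_int (x * y)"
proof -
  obtain d where d: "d > 0" "x ^ d \<in> int_module.span ((\<lambda>i. x ^ i) ` {..<d})"
    using algebraic_int_power_in_span[OF assms(1)] .
  obtain e where e: "e > 0" "y ^ e \<in> int_module.span ((\<lambda>i. y ^ i) ` {..<e})"
    using algebraic_int_power_in_span[OF assms(2)] .
  \<comment> \<open>The span of \<open>S\<close> is stable under multiplication by both \<open>x\<close> and \<open>y\<close>.\<close>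
  define S where "S = (\<lambda>(i, j). x ^ i * y ^ j) ` ({..<d} \<times> {..<e})"
  have S: "x ^ i * y ^ j \<in> int_module.span S" if "i < d" "j < e" for i j
    by (rule int_module.span_base) (use that in \<open>auto simp: S_def\<close>)
  have x_base: "s * x \<in> int_module.span S" if "s \<in> S" for s
  proof -
    from that obtain i j where ij: "s = x ^ i * y ^ j" "i < d" "j < e" by (auto simp: S_def)
    show ?thesis
    proof (cases "Suc i < d")
      case True
      thus ?thesis using S[of "Suc i" j] ij by (simp add: mult_ac)
    next
      case False
      \<comment> \<open>Here \<open>i = d - 1\<close>: the exponent leaves the allowed range, and
        the relation for \<open>x ^ d\<close> brings the product back into the span.\<close>
      hence "s * x = x ^ d * y ^ j" using ij by (metis Suc_lessI power_Suc2 mult.assoc mult.commute)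
      moreover have "x ^ d * y ^ j \<in> int_module.span S"
        by (rule span_mult_right[OF d(2)]) (use S ij in auto)
      ultimately show ?thesis by simp
    qed
  qed
  have y_base: "s * y \<in> int_module.span S" if "s \<in> S" for s
  proof -
    from that obtain i j where ij: "s = x ^ i * y ^ j" "i < d" "j < e" by (auto simp: S_def)
    show ?thesis
    proof (cases "Suc j < e")
      case True
      thus ?thesis using S[of i "Suc j"] ij by (simp add: mult_ac)
    next
      case False
      hence "s * y = y ^ e * x ^ i" using ij by (metis Suc_lessI power_Suc2 mult.assoc mult.commute)
      moreover have "y ^ e * x ^ i \<in> int_module.span S"
        by (rule span_mult_right[OF e(2)]) (use S ij in \<open>auto simp: mult.commute[of _ "x ^ i"]\<close>)
      ultimately show ?thesis by simp
    qed
  qed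
  have one: "1 \<in> S" and fin: "finite S"
    using d(1) e(1) by (auto simp: S_def intro!: image_eqI[of _ _ "(0, 0)"])
  have "(x + y) * s \<in> int_module.span S" if "s \<in> S" for s
    using int_module.span_add[OF x_base[OF that] y_base[OF that]] by (simp add: algebra_simps)
  thus "algebraic_int (x + y)"
    using algebraic_int_if_stable_span[OF fin one] by simp
  \<comment> \<open>Multiplication by \<open>x\<close> maps \<open>s\<close> into the span, and
    multiplication by \<open>y\<close> then maps the span to itself.\<close>
  have "(x * y) * s \<in> int_module.span S" if "s \<in> S" for s
    using span_mult_right[OF x_base[OF that] y_base] by (simp add: mult_ac)
  thus "algebraic_int (x * y)"
    using algebraic_int_if_stable_span[OF fin one] by simp
qed

lemma algebraic_int_diff:
  fixes x y :: "'a::field_char_0"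
  assumes "algebraic_int x" "algebraic_int y"
  shows "algebraic_int (x - y)"
  using algebraic_int_plus[of x "- y"] assms by simp

lemma algebraic_int_sum:
  fixes f :: "'b \<Rightarrow> 'a::field_char_0"
  assumes "\<And>i. i \<in> I \<Longrightarrow> algebraic_int (f i)"
  shows "algebraic_int (\<Sum>i\<in>I. f i)"
  using assms by (induction I rule: infinite_finite_induct) (auto intro: algebraic_int_plus)

lemma algebraic_int_prod:
  fixes f :: "'b \<Rightarrow> 'a::field_char_0"
  assumes "\<And>i. i \<in> I \<Longrightarrow> algebraic_int (f i)"
  shows "algebraic_int (\<Prod>i\<in>I. f i)"
  using assms by (induction I rule: infinite_finite_induct) (auto intro: algebraic_int_times)

lemma algebraic_int_power:
  fixes x :: "'a::field_char_0"
  assumes "algebraic_int x"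
  shows "algebraic_int (x ^ n)"
  using assms by (induction n) (auto intro: algebraic_int_times)

lemma algebraic_int_root_of_unity:
  fixes x :: "'a::field_char_0"
  assumes "x ^ n = 1" "n > 0"
  shows "algebraic_int x"
  by (rule algebraic_int_root[of 1 "Polynomial.monom 1 n"])
     (use assms in \<open>auto simp: poly_monom degree_monom_eq\<close>)

section \<open>Congruences in the ring of algebraic integers\<close>

lemma alg_int_cong_refl: "alg_int_cong x x d"
  unfolding alg_int_cong_def by (intro exI[of _ 0]) simp

lemma alg_int_cong_sym: "alg_int_cong x y d \<Longrightarrow> alg_int_cong y x d"
  unfolding alg_int_cong_def
  by (metis algebraic_int_minus minus_diff_eq mult_minus_right)

lemma alg_int_cong_trans:
  assumes "alg_int_cong x y d" "alg_int_cong y z d"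
  shows "alg_int_cong x z d"
proof -
  from assms obtain c c' where c: "algebraic_int c" "x - y = d * c" "algebraic_int c'" "y - z = d * c'"
    unfolding alg_int_cong_def by blast
  have "x - z = (x - y) + (y - z)" by simp
  also have "\<dots> = d * (c + c')" unfolding c by (simp add: distrib_left)
  finally have "x - z = d * (c + c')" .
  thus ?thesis using algebraic_int_plus[OF c(1,3)] by (auto simp: alg_int_cong_def)
qed

text \<open>The relation does not force its arguments to be algebraic integers. In
  \<open>x * (x' - y') + (x - y) * y'\<close> the numbers \<open>x\<close> and \<open>y'\<close>
  multiply the cofactors, hence the two integrality hypotheses.\<close>

lemma alg_int_cong_mult:
  assumes "alg_int_cong x y d" "alg_int_cong x' y' d" "algebraic_int x" "algebraic_int y'"
  shows "alg_int_cong (x * x') (y * y') d"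
proof -
  from assms obtain c c' where c: "algebraic_int c" "x - y = d * c" "algebraic_int c'" "x' - y' = d * c'"
    unfolding alg_int_cong_def by blast
  have "x * x' - y * y' = x * (x' - y') + (x - y) * y'"
    by (simp add: algebra_simps)
  also have "\<dots> = d * (x * c' + c * y')" unfolding c by (simp add: algebra_simps)
  finally have "x * x' - y * y' = d * (x * c' + c * y')" .
  moreover have "algebraic_int (x * c' + c * y')"
    using assms c by (intro algebraic_int_plus algebraic_int_times)
  ultimately show ?thesis unfolding alg_int_cong_def by blast
qed

lemma alg_int_cong_prod:
  assumes "\<And>i. i \<in> I \<Longrightarrow> alg_int_cong (f i) (g i) d"
    and "\<And>i. i \<in> I \<Longrightarrow> algebraic_int (f i)" "\<And>i. i \<in> I \<Longrightarrow> algebraic_int (g i)"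
  shows "alg_int_cong (\<Prod>i\<in>I. f i) (\<Prod>i\<in>I. g i) d"
  using assms
  by (induction I rule: infinite_finite_induct)
     (auto intro!: alg_int_cong_mult alg_int_cong_refl algebraic_int_prod)

text \<open>Brings congruences back to the integers: the quotient of \<open>x - y\<close> by
  \<open>p\<close> is a rational algebraic integer, hence an integer.\<close>

lemma alg_int_cong_of_int_iff:
  assumes "p > 0"
  shows "alg_int_cong (of_int x) (of_int y) (of_nat p) \<longleftrightarrow> [x = y] (mod int p)"
proof
  assume "alg_int_cong (of_int x) (of_int y) (of_nat p)"
  then obtain c where c: "algebraic_int c" "complex_of_int x - of_int y = of_nat p * c"
    unfolding alg_int_cong_def by blast
  hence "c = of_int (x - y) / of_nat p"
    using assms by simp
  also have "\<dots> \<in> \<rat>" by (intro Rats_divide Rats_of_int Rats_of_nat)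
  finally have "c \<in> \<int>" using c(1) rational_algebraic_int_is_int by blast
  then obtain k where "c = of_int k" by (auto elim: Ints_cases)
  hence "complex_of_int (x - y) = of_int (int p * k)" using c(2) by simp
  hence "x - y = int p * k" by (simp only: of_int_eq_iff)
  thus "[x = y] (mod int p)" by (simp add: cong_iff_dvd_diff)
next
  assume "[x = y] (mod int p)"
  then obtain k where "x - y = int p * k" by (auto simp: cong_iff_dvd_diff)
  hence "complex_of_int (x - y) = of_int (int p * k)" by simp
  thus "alg_int_cong (of_int x) (of_int y) (of_nat p)"
    unfolding alg_int_cong_def by (intro exI[of _ "of_int k"]) simp
qed

text \<open>The inner binomial coefficients are divisible by \<open>p\<close>; the cofactor
  \<open>c\<close> is the sum with these coefficients divided by \<open>p\<close>.\<close>

lemma alg_int_cong_freshmans_dream: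
  assumes "prime p" "algebraic_int x" "algebraic_int y"
  shows "alg_int_cong ((x + y) ^ p) (x ^ p + y ^ p) (of_nat p)"
proof -
  define c where "c = (\<Sum>k\<in>{0<..<p}. of_nat ((p choose k) div p) * (x ^ k * y ^ (p - k)))"
  have p0: "0 < p" using prime_gt_0_nat[OF assms(1)] .
  have *: "of_nat (p choose k) = (of_nat p * of_nat ((p choose k) div p) :: complex)"
    if "k \<in> {0<..<p}" for k
  proof -
    have "p dvd (p choose k)" using that assms(1) by (intro dvd_choose_prime) auto
    thus ?thesis by (simp flip: of_nat_mult)
  qed
  have "(x + y) ^ p = (\<Sum>k\<in>insert 0 (insert p {0<..<p}). of_nat (p choose k) * x ^ k * y ^ (p - k))"
    unfolding binomial_ring by (rule sum.cong) auto
  also have "\<dots> = x ^ p + y ^ p + (\<Sum>k\<in>{0<..<p}. of_nat (p choose k) * x ^ k * y ^ (p - k))"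
    using p0 by simp
  also have "(\<Sum>k\<in>{0<..<p}. of_nat (p choose k) * x ^ k * y ^ (p - k)) = of_nat p * c"
    unfolding c_def sum_distrib_left by (rule sum.cong) (auto simp: * mult_ac)
  finally have "(x + y) ^ p - (x ^ p + y ^ p) = of_nat p * c" by simp
  moreover have "algebraic_int c" unfolding c_def
    by (intro algebraic_int_sum algebraic_int_times algebraic_int_power algebraic_int_of_nat assms)
  ultimately show ?thesis by (auto simp: alg_int_cong_def)
qed

section \<open>Roots of unity modulo p and the value of the residue symbol\<close>

lemma one_minus_root_of_unity_dvd:
  fixes z :: "'a::field_char_0"
  assumes "z ^ n = 1" "n > 0" "z \<noteq> 1"
  obtains u where "algebraic_int u" "(1 - z) * u = of_nat n"
proof
  \<comment> \<open>\<open>n\<close> is the sum of the \<open>1 - z ^ j\<close> over \<open>j < n\<close>, and each of them is a multiple of \<open>1 - z\<close>.\<close>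
  define u where "u = (\<Sum>j<n. \<Sum>i<j. z ^ i)"
  have z: "algebraic_int z" using assms(1,2) by (rule algebraic_int_root_of_unity)
  show "algebraic_int u"
    unfolding u_def by (intro algebraic_int_sum algebraic_int_power z)
  have "(1 - z) * (\<Sum>i<n. z ^ i) = 0" using assms(1) one_diff_power_eq[of z n] by simp
  hence "(\<Sum>i<n. z ^ i) = 0" using assms(3) by simp
  moreover have "(1 - z) * u = (\<Sum>j<n. 1 - z ^ j)"
    unfolding u_def one_diff_power_eq by (simp add: sum_distrib_left)
  ultimately show "(1 - z) * u = of_nat n" by (simp add: sum_subtractf)
qed

text \<open>If \<open>z \<noteq> 1\<close>, then \<open>p\<close> divides \<open>1 - z\<close>,
  which divides \<open>n\<close>. So \<open>p\<close> divides \<open>n\<close> already in the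
  integers, against \<open>0 < n < p\<close>.\<close>

lemma root_of_unity_eq_one_if_cong:
  assumes "alg_int_cong 1 z (of_nat p)" "z ^ n = 1" "0 < n" "n < p"
  shows "z = 1"
proof (rule ccontr)
  assume "z \<noteq> 1"
  then obtain u where u: "algebraic_int u" "(1 - z) * u = of_nat n"
    using one_minus_root_of_unity_dvd[OF assms(2,3)] by metis
  obtain c where c: "algebraic_int c" "1 - z = of_nat p * c"
    using assms(1) unfolding alg_int_cong_def by blast
  have "alg_int_cong (of_int (int n)) (of_int 0) (of_nat p)"
    unfolding alg_int_cong_def using u c algebraic_int_times[OF c(1) u(1)]
    by (intro exI[of _ "c * u"]) (simp add: mult_ac)
  hence "int p dvd int n" using assms(4) by (subst (asm) alg_int_cong_of_int_iff) (auto simp: cong_0_iff)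
  with assms(3,4) show False by (auto dest: zdvd_imp_le)
qed

text \<open>Uniqueness is the point: for any candidate \<open>z\<close>, the number
  \<open>s * z\<close> is an \<open>n\<close>-th root of unity congruent to
  \<open>s * s = 1\<close>, hence equal to 1.\<close>

lemma power_residue_symbol_eq_of_int:
  assumes "0 < n" "n < p" "s = 1 \<or> s = -1" "s ^ n = 1" "[b ^ ((p - 1) div n) = s] (mod int p)"
  shows "power_residue_symbol n p b = of_int s"
  unfolding power_residue_symbol_def
proof (rule the_equality)
  have s: "(of_int s :: complex) ^ n = 1" using assms(4) by (metis of_int_1 of_int_power)
  have b: "alg_int_cong (of_int (b ^ ((p - 1) div n))) (of_int s) (of_nat p)"
    using assms by (subst alg_int_cong_of_int_iff) auto
  thus "of_int s ^ n = (1::complex) \<and> alg_int_cong (of_int (b ^ ((p - 1) div n))) (of_int s) (of_nat p)"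
    using s by blast
  fix z :: complex
  assume z: "z ^ n = 1 \<and> alg_int_cong (of_int (b ^ ((p - 1) div n))) z (of_nat p)"
  hence "alg_int_cong (of_int s) z (of_nat p)" using b alg_int_cong_sym alg_int_cong_trans by blast
  hence "alg_int_cong (of_int s * of_int s) (of_int s * z) (of_nat p)"
    using z algebraic_int_root_of_unity[of z n] assms(1)
    by (intro alg_int_cong_mult alg_int_cong_refl) auto
  hence "alg_int_cong 1 (of_int s * z) (of_nat p)" using assms(3) by auto
  moreover have "(of_int s * z) ^ n = 1" using z s by (simp add: power_mult_distrib)
  ultimately have "of_int s * z = 1" using root_of_unity_eq_one_if_cong assms by blast
  hence "of_int s * (of_int s * z) = of_int s" by simp
  moreover have "of_int s * of_int s = (1 :: complex)" using assms(3) by auto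
  ultimately show "z = of_int s" by (simp flip: mult.assoc)
qed

section \<open>The group of m-th power residues\<close>

lemma power_residue_mult:
  assumes "prime p" "power_residue m p b" "power_residue m p c"
  shows "power_residue m p (b * c)"
proof -
  from assms obtain x y where "[x ^ m = b] (mod int p)" "[y ^ m = c] (mod int p)"
    by (auto simp: power_residue_def)
  hence "[(x * y) ^ m = b * c] (mod int p)"
    by (simp add: power_mult_distrib cong_mult)
  moreover have "\<not> int p dvd b * c"
    using assms by (auto simp: power_residue_def cong_0_iff prime_dvd_mult_iff)
  ultimately show ?thesis by (auto simp: power_residue_def cong_0_iff)
qed

lemma power_residue_cong:
  assumes "[b = c] (mod int p)"
  shows "power_residue m p b \<longleftrightarrow> power_residue m p c"
  using assms unfolding power_residue_def by (metis cong_sym cong_trans)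

lemma finite_power_residues [simp]: "finite (power_residues m p)"
  by (simp add: power_residues_def)

lemma mod_in_power_residues:
  assumes "prime p" "power_residue m p b"
  shows "nat (b mod int p) \<in> power_residues m p"
proof -
  have p0: "int p > 0" using prime_gt_0_nat[OF assms(1)] by simp
  have "power_residue m p (b mod int p)"
    using power_residue_cong[of "b mod int p" b p m] assms(2) by simp
  moreover from this have "b mod int p \<noteq> 0" by (auto simp: power_residue_def cong_0_iff)
  moreover have "0 \<le> b mod int p" "b mod int p < int p" using p0 by simp_all
  ultimately show ?thesis by (auto simp: power_residues_def)
qed

text \<open>Multiplying by \<open>c\<close> and reducing modulo \<open>p\<close> permutes the
  residues: it is injective because \<open>c\<close> is a unit modulo \<open>p\<close>, and the set
  is finite.\<close>

lemma prod_power_residues_mult: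
  fixes g :: "int \<Rightarrow> 'a::comm_monoid_mult"
  assumes "prime p" "power_residue m p c" "\<And>j. g (j mod int p) = g j"
  shows "(\<Prod>k\<in>power_residues m p. g (c * int k)) = (\<Prod>k\<in>power_residues m p. g (int k))"
proof -
  define R where "R = power_residues m p"
  define h where "h k = nat (c * int k mod int p)" for k
  have p0: "int p > 0" using prime_gt_0_nat[OF assms(1)] by simp
  have h: "int (h k) = c * int k mod int p" for k using p0 by (simp add: h_def)
  have "h k \<in> R" if "k \<in> R" for k
    unfolding R_def h_def
    by (intro mod_in_power_residues power_residue_mult assms(1,2))
       (use that in \<open>simp add: R_def power_residues_def\<close>)
  hence "h ` R \<subseteq> R" by blast
  moreover have "inj_on h R"
  proof (rule inj_onI)
    fix k l assume kl: "k \<in> R" "l \<in> R" "h k = h l"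
    hence "[c * int k = c * int l] (mod int p)" using h by (metis cong_def)
    moreover have "coprime (int p) c"
      using assms(1,2) by (intro prime_imp_coprime) (simp_all add: power_residue_def cong_0_iff)
    ultimately have "[k = l] (mod p)"
      by (simp add: cong_mult_lcancel cong_int_iff coprime_commute[of c])
    moreover have "k < p" "l < p" using kl p0 by (auto simp: R_def power_residues_def)
    ultimately show "k = l" by (simp add: cong_def)
  qed
  ultimately have "bij_betw h R R"
    using endo_inj_surj[of R h] by (auto simp: bij_betw_def R_def)
  have "(\<Prod>k\<in>R. g (c * int k)) = (\<Prod>k\<in>R. g (int (h k)))"
    by (simp add: h assms(3))
  also have "\<dots> = (\<Prod>k\<in>R. g (int k))" by (rule prod.reindex_bij_betw) fact
  finally show ?thesis by (simp add: R_def)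
qed

text \<open>For a primitive root \<open>g\<close>, of order \<open>m * n\<close>, the residues are
  the powers \<open>g ^ (m * j)\<close> with \<open>j < n\<close>, and these are distinct modulo
  \<open>p\<close>.\<close>

lemma card_power_residues:
  assumes "prime p" "p - 1 = m * n"
  shows "card (power_residues m p) = n"
proof -
  have p1: "p > 1" using prime_gt_1_nat[OF assms(1)] .
  hence "m > 0" "n > 0" using assms(2) by (auto intro!: Nat.gr0I)
  obtain g where g: "residue_primroot p g"
    using prime_primitive_root_exists[of p] assms(1) p1 by blast
  hence ord: "ord p g = m * n" and cop: "coprime p g"
    using assms by (simp_all add: residue_primroot_def totient_prime)
  have eq_iff: "[g ^ i = g ^ j] (mod p) \<longleftrightarrow> [i = j] (mod m * n)" for i j
    using order_divides_expdiff[OF cop] ord by simp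
  define f where "f j = g ^ (m * j) mod p" for j
  have ndvd: "\<not> p dvd g" using cop assms(1) p1 by (metis coprime_absorb_left not_prime_unit)
  have "inj_on f {..<n}"
  proof (rule inj_onI)
    fix i j assume ij: "i \<in> {..<n}" "j \<in> {..<n}" "f i = f j"
    hence "[m * i = m * j] (mod m * n)" using eq_iff by (simp add: f_def cong_def)
    thus "i = j" using ij \<open>m > 0\<close> by (simp add: cong_def mult_mod_right[symmetric])
  qed
  moreover have "f ` {..<n} = power_residues m p"
  proof (intro equalityI subsetI)
    fix k assume "k \<in> f ` {..<n}"
    then obtain j where j: "k = f j" by auto
    have "power_residue m p (int (g ^ (m * j)))" unfolding power_residue_def
    proof (intro conjI exI[of _ "int (g ^ j)"])
      show "\<not> [int (g ^ (m * j)) = 0] (mod int p)"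
        using ndvd assms(1) by (auto simp: cong_0_iff prime_dvd_power_iff int_dvd_int_iff simp flip: of_nat_power dest: prime_dvd_power)
      show "[int (g ^ j) ^ m = int (g ^ (m * j))] (mod int p)"
        by (simp add: power_mult[symmetric] mult.commute)
    qed
    hence "nat (int (g ^ (m * j)) mod int p) \<in> power_residues m p"
      by (rule mod_in_power_residues[OF assms(1)])
    thus "k \<in> power_residues m p" by (simp add: j f_def flip: of_nat_mod of_nat_power)
  next
    fix k assume "k \<in> power_residues m p"
    then obtain x where x: "[x ^ m = int k] (mod int p)" and k: "0 < k" "k < p"
      using p1 by (auto simp: power_residues_def power_residue_def)
    define y where "y = nat (x mod int p)"
    have y: "int y = x mod int p" using p1 by (simp add: y_def)
    have "[int y ^ m = int k] (mod int p)" using x unfolding y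
      by (metis cong_def power_mod)
    hence ym: "[y ^ m = k] (mod p)" by (simp flip: of_nat_power add: cong_int_iff)
    have "\<not> p dvd y"
    proof
      assume "p dvd y"
      hence "p dvd y ^ m" using \<open>m > 0\<close> by (simp add: dvd_power_same dvd_trans[OF _ dvd_power])
      hence "p dvd k" using ym by (simp add: cong_dvd_iff)
      thus False using k by (auto dest: dvd_imp_le)
    qed
    hence "coprime y p" using assms(1) by (meson coprime_commute prime_imp_coprime)
    moreover have "y < p" using p1 by (simp add: y_def nat_less_iff)
    moreover have "y > 0" using \<open>\<not> p dvd y\<close> by (auto intro!: Nat.gr0I)
    ultimately have "y \<in> totatives p" by (simp add: totatives_def)
    then obtain i where "y = g ^ i mod p"
      using residue_primroot_is_generator[OF p1 g] by (auto simp: bij_betw_def)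
    hence "[y ^ m = (g ^ i) ^ m] (mod p)" by (simp add: cong_def power_mod)
    hence "[k = g ^ (m * i)] (mod p)" using ym
      by (metis cong_sym cong_trans power_mult mult.commute)
    \<comment> \<open>Exponents count modulo \<open>m * n\<close>, so in \<open>m * i\<close> only
      \<open>i\<close> modulo \<open>n\<close> matters.\<close>
    moreover have "[g ^ (m * i) = g ^ (m * (i mod n))] (mod p)"
      unfolding eq_iff by (simp only: cong_def mult_mod_right mod_mod_trivial)
    ultimately have "[k = g ^ (m * (i mod n))] (mod p)" by (rule cong_trans)
    hence "k = f (i mod n)" using k by (simp add: f_def cong_def)
    thus "k \<in> f ` {..<n}" using \<open>n > 0\<close> by auto
  qed
  ultimately have "card (power_residues m p) = card {..<n}" by (metis card_image)
  thus ?thesis by simp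
qed

text \<open>If \<open>b\<close> is \<open>x ^ m\<close> modulo \<open>p\<close>, then
  \<open>b ^ n\<close> is \<open>x ^ (p - 1)\<close>, and Fermat's theorem applies to the natural
  representative \<open>y\<close> of \<open>x\<close>.\<close>

lemma power_residue_power_eq_1:
  assumes "prime p" "p - 1 = m * n" "power_residue m p b"
  shows "[b ^ n = 1] (mod int p)"
proof -
  have p0: "p > 0" using prime_gt_0_nat[OF assms(1)] .
  obtain x where x: "[x ^ m = b] (mod int p)" and b: "\<not> int p dvd b"
    using assms(3) by (auto simp: power_residue_def cong_0_iff)
  have "p - 1 > 0" using prime_gt_1_nat[OF assms(1)] by simp
  hence "m > 0" using assms(2) by (auto intro!: Nat.gr0I)
  define y where "y = nat (x mod int p)"
  have y: "[int y = x] (mod int p)" using p0 by (simp add: y_def)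
  have "\<not> int p dvd x"
  proof
    assume "int p dvd x"
    hence "int p dvd x ^ m" using \<open>m > 0\<close> by (meson dvd_power dvd_trans)
    thus False using x b by (simp add: cong_dvd_iff)
  qed
  hence "\<not> p dvd y" using cong_dvd_iff[OF y] by (metis int_dvd_int_iff cong_dvd_iff)
  hence "[y ^ (p - 1) = 1] (mod p)" using fermat_theorem[OF assms(1)] by blast
  hence "[int y ^ (p - 1) = 1] (mod int p)"
    by (metis cong_int_iff of_nat_1 of_nat_power)
  moreover have "[b ^ n = (x ^ m) ^ n] (mod int p)" by (intro cong_pow cong_sym[OF x])
  moreover have "[(x ^ m) ^ n = int y ^ (p - 1)] (mod int p)"
    unfolding assms(2) power_mult by (intro cong_pow cong_sym[OF y])
  ultimately show ?thesis using cong_trans by blast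
qed

text \<open>For a primitive root \<open>g\<close>, the power \<open>t\<close> with exponent
  \<open>h * m\<close>, half of \<open>p - 1\<close>, has square 1 but is not 1 modulo
  \<open>p\<close>. So it is -1, and it is visibly an \<open>m\<close>-th power.\<close>

lemma power_residue_minus_one:
  assumes "prime p" "p - 1 = 2 * m * h"
  shows "power_residue m p (- 1)"
proof -
  have p1: "p > 1" using prime_gt_1_nat[OF assms(1)] .
  hence mh: "m * h > 0" using assms(2) by (auto intro!: Nat.gr0I)
  obtain g where g: "residue_primroot p g"
    using prime_primitive_root_exists[of p] assms(1) p1 by blast
  hence ord: "ord p g = 2 * m * h"
    using assms by (simp add: residue_primroot_def totient_prime)
  define t where "t = int g ^ (h * m)"
  have "[g ^ (2 * m * h) = 1] (mod p)" using ord ord_works[of g p] by simp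
  hence "[int g ^ (2 * m * h) = 1] (mod int p)"
    by (metis cong_int_iff of_nat_1 of_nat_power)
  hence "int p dvd t\<^sup>2 - 1" by (simp add: cong_iff_dvd_diff t_def mult_ac flip: power_mult)
  also have "t\<^sup>2 - 1 = (t - 1) * (t + 1)" by (simp add: power2_eq_square algebra_simps)
  finally have "int p dvd t - 1 \<or> int p dvd t + 1"
    using assms(1) by (simp add: prime_dvd_mult_iff)
  moreover have "\<not> int p dvd t - 1"
  proof
    assume "int p dvd t - 1"
    hence "[int (g ^ (h * m)) = int 1] (mod int p)" by (simp add: t_def cong_iff_dvd_diff)
    hence "[g ^ (h * m) = 1] (mod p)" by (simp only: cong_int_iff)
    hence "2 * m * h dvd h * m" by (simp only: ord_divides ord)
    thus False using mh by (auto dest: dvd_imp_le)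
  qed
  ultimately have "[(int g ^ h) ^ m = - 1] (mod int p)"
    by (simp add: t_def cong_iff_dvd_diff flip: power_mult)
  moreover have "\<not> [- 1 = 0] (mod int p)" using p1 by (simp add: cong_0_iff)
  ultimately show ?thesis by (auto simp: power_residue_def)
qed

section \<open>Products over the power residues at a p-th root of unity\<close>

text \<open>By Bezout, \<open>z\<close> is a product of integer powers of \<open>z ^ k\<close> and
  \<open>z ^ p\<close>.\<close>

lemma root_of_unity_power_neq_one:
  fixes z :: "'a::field"
  assumes "prime p" "z ^ p = 1" "z \<noteq> 1" "\<not> p dvd k"
  shows "z ^ k \<noteq> 1"
proof
  assume zk: "z ^ k = 1"
  have "z \<noteq> 0" using assms(1,2) prime_gt_0_nat[of p] by (auto simp: power_0_left)
  have "coprime (int k) (int p)"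
    using assms(1,4) by (metis coprime_commute coprime_int_iff prime_imp_coprime)
  then obtain u v where uv: "u * int k + v * int p = 1"
    using bezout_int[of "int k" "int p"] by auto
  have "z = z powi (int k * u + int p * v)" using uv by (simp add: mult.commute)
  also have "\<dots> = 1" using zk assms(2) \<open>z \<noteq> 0\<close> by (simp add: power_int_add power_int_mult)
  finally show False using assms(3) by simp
qed

text \<open>Integer exponents allow multiplication of the index by -1; this is the periodicity
  demanded by \<open>prod_power_residues_mult\<close>.\<close>

lemma power_int_mod_root_of_unity:
  fixes z :: "'a::field"
  assumes "z ^ p = 1" "p > 0"
  shows "z powi (j mod int p) = z powi j"
proof -
  have "z \<noteq> 0" using assms by (auto simp: power_0_left)
  have "z powi j = z powi (int p * (j div int p) + j mod int p)" by simp
  also have "\<dots> = z powi (j mod int p)"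
    using assms \<open>z \<noteq> 0\<close> by (subst power_int_add) (simp_all add: power_int_mult)
  finally show ?thesis ..
qed

lemma power_int_double: "z powi (2 * int k) = z ^ k * z ^ k" for z :: "'a::field"
proof -
  have "z powi (2 * int k) = z powi int (2 * k)" by simp
  thus ?thesis by (simp only: power_int_of_nat mult_2 power_add)
qed

text \<open>Applied with \<open>c = 2\<close> and \<open>c = - 1\<close>, that is, to square or
  invert all the \<open>z ^ k\<close> at once.\<close>

lemma prod_power_residues_power_int:
  fixes z :: "'a::field" and g :: "'a \<Rightarrow> 'b::comm_monoid_mult"
  assumes "prime p" "z ^ p = 1" "power_residue m p c"
  shows "(\<Prod>k\<in>power_residues m p. g (z powi (c * int k))) = (\<Prod>k\<in>power_residues m p. g (z ^ k))"
  using prod_power_residues_mult[of p m c "\<lambda>j. g (z powi j)"] assms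
        power_int_mod_root_of_unity[of z p] prime_gt_0_nat[of p] by simp

lemma prod_one_plus_root_of_unity:
  fixes z :: "'a::field"
  assumes "prime p" "z ^ p = 1" "z \<noteq> 1" "power_residue m p 2"
  shows "(\<Prod>k\<in>power_residues m p. 1 + z ^ k) = 1"
proof -
  define R where "R = power_residues m p"
  \<comment> \<open>Permits cancelling the product of the \<open>1 - z ^ k\<close> at the
    end.\<close>
  have "1 - z ^ k \<noteq> 0" if "k \<in> R" for k
  proof -
    have "0 < k" "k < p" using that by (auto simp: R_def power_residues_def)
    thus ?thesis using root_of_unity_power_neq_one[OF assms(1-3), of k] nat_dvd_not_less by auto
  qed
  hence nz: "(\<Prod>k\<in>R. 1 - z ^ k) \<noteq> 0" by (simp add: R_def)
  have "(\<Prod>k\<in>R. 1 - z ^ k) = (\<Prod>k\<in>R. 1 - z powi (2 * int k))"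
    unfolding R_def by (rule prod_power_residues_power_int[OF assms(1,2,4), symmetric])
  also have "\<dots> = (\<Prod>k\<in>R. (1 - z ^ k) * (1 + z ^ k))"
    by (rule prod.cong[OF refl]) (unfold power_int_double, simp add: algebra_simps)
  also have "\<dots> = (\<Prod>k\<in>R. 1 - z ^ k) * (\<Prod>k\<in>R. 1 + z ^ k)" by (rule prod.distrib)
  finally show ?thesis using nz by (simp add: R_def)
qed

text \<open>Inverting all factors permutes them, so the product \<open>E\<close> satisfies
  \<open>E * E = 1\<close>. Also \<open>E ^ p = 1\<close>, and \<open>p\<close> is odd.\<close>

lemma prod_root_of_unity_power_residues:
  fixes z :: "'a::field"
  assumes "prime p" "odd p" "z ^ p = 1" "power_residue m p (- 1)"
  shows "(\<Prod>k\<in>power_residues m p. z ^ k) = 1"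
proof -
  define E where "E = (\<Prod>k\<in>power_residues m p. z ^ k)"
  have "z \<noteq> 0" using assms prime_gt_0_nat[of p] by (auto simp: power_0_left)
  have "E = (\<Prod>k\<in>power_residues m p. z powi (- 1 * int k))"
    unfolding E_def by (rule prod_power_residues_power_int[OF assms(1,3,4), symmetric])
  also have "\<dots> = inverse E" by (simp add: E_def power_int_minus o_def flip: prod_inversef)
  finally have "E = inverse E" .
  moreover have "E \<noteq> 0" using \<open>z \<noteq> 0\<close> by (simp add: E_def)
  ultimately have "E * E = 1" by (metis right_inverse)
  have "E ^ p = (\<Prod>k\<in>power_residues m p. (z ^ p) ^ k)"
    unfolding E_def prod_power_distrib by (simp add: mult.commute flip: power_mult)
  hence "E ^ p = 1" using assms(3) by simp
  moreover obtain q where "p = 2 * q + 1" using assms(2) by (elim oddE)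
  hence "E ^ p = (E * E) ^ q * E" by (simp add: power_mult power2_eq_square)
  ultimately show ?thesis using \<open>E * E = 1\<close> by (simp add: E_def)
qed

text \<open>Doubling the index gives \<open>Q * Q' = 1\<close>. Negating it turns \<open>Q\<close>
  into \<open>Q'\<close> up to a power of \<open>\<i>\<close>, since
  \<open>inverse w + \<i> = \<i> * inverse w * (w - \<i>)\<close> for
  \<open>w \<noteq> 0\<close>.\<close>

lemma prod_root_of_unity_plus_ii_squared:
  fixes z :: complex
  assumes "prime p" "odd p" "z ^ p = 1" "z \<noteq> 1" "power_residue m p 2" "power_residue m p (- 1)"
  shows "(\<Prod>k\<in>power_residues m p. z ^ k + \<i>) ^ 2 = \<i> ^ card (power_residues m p)"
proof -
  define R where "R = power_residues m p"
  define Q where "Q = (\<Prod>k\<in>R. z ^ k + \<i>)"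
  define Q' where "Q' = (\<Prod>k\<in>R. z ^ k - \<i>)"
  have "z \<noteq> 0" using assms prime_gt_0_nat[of p] by (auto simp: power_0_left)
  have "Q * Q' = (\<Prod>k\<in>R. 1 + z powi (2 * int k))"
    unfolding Q_def Q'_def prod.distrib[symmetric]
    by (rule prod.cong[OF refl]) (unfold power_int_double, simp add: algebra_simps)
  also have "\<dots> = (\<Prod>k\<in>R. 1 + z ^ k)"
    unfolding R_def by (rule prod_power_residues_power_int[OF assms(1,3,5)])
  also have "\<dots> = 1" unfolding R_def by (rule prod_one_plus_root_of_unity[OF assms(1,3,4,5)])
  finally have QQ': "Q * Q' = 1" .
  have "Q = (\<Prod>k\<in>R. z powi (- 1 * int k) + \<i>)"
    unfolding Q_def R_def by (rule prod_power_residues_power_int[OF assms(1,3,6), symmetric])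
  also have "\<dots> = (\<Prod>k\<in>R. \<i> * inverse (z ^ k) * (z ^ k - \<i>))"
    by (rule prod.cong[OF refl]) (use \<open>z \<noteq> 0\<close> in \<open>simp add: power_int_minus field_simps\<close>)
  also have "\<dots> = \<i> ^ card R * inverse (\<Prod>k\<in>R. z ^ k) * Q'"
    by (simp add: prod.distrib Q'_def o_def flip: prod_inversef)
  also have "(\<Prod>k\<in>R. z ^ k) = 1"
    unfolding R_def by (rule prod_root_of_unity_power_residues[OF assms(1-3,6)])
  finally have "Q = \<i> ^ card R * Q'" by simp
  hence "Q ^ 2 = \<i> ^ card R * (Q * Q')" by (simp add: power2_eq_square mult_ac)
  thus ?thesis using QQ' by (simp add: Q_def R_def)
qed

text \<open>The \<open>p\<close>-th power eliminates \<open>z\<close>, because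
  \<open>(z ^ k) ^ p = 1\<close>; every factor then contributes the same constant.\<close>

lemma prod_root_of_unity_plus_ii_cong:
  fixes z :: complex and R :: "nat set"
  assumes "prime p" "odd p" "z ^ p = 1"
  shows "alg_int_cong ((\<Prod>k\<in>R. (1 - \<i>) * (z ^ k + \<i>)) ^ p) (2 ^ card R) (of_nat p)"
proof -
  have p0: "p > 0" using prime_gt_0_nat[OF assms(1)] .
  have z: "algebraic_int z" using assms(3) p0 by (rule algebraic_int_root_of_unity)
  have mi: "algebraic_int (- \<i>)" by simp
  note closure = algebraic_int_plus algebraic_int_times algebraic_int_power algebraic_int_diff
    algebraic_int_1 algebraic_int_ii z mi
  have "alg_int_cong (((1 - \<i>) * (z ^ k + \<i>)) ^ p) 2 (of_nat p)" for k
  proof -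
    have "alg_int_cong ((1 + - \<i>) ^ p) (1 ^ p + (- \<i>) ^ p) (of_nat p)"
      using assms(1) by (intro alg_int_cong_freshmans_dream closure)
    moreover have "alg_int_cong ((z ^ k + \<i>) ^ p) ((z ^ k) ^ p + \<i> ^ p) (of_nat p)"
      using assms(1) by (intro alg_int_cong_freshmans_dream closure)
    moreover have "algebraic_int ((1 + - \<i>) ^ p)" "algebraic_int ((z ^ k) ^ p + \<i> ^ p)"
      by (intro closure)+
    ultimately have "alg_int_cong ((1 + - \<i>) ^ p * (z ^ k + \<i>) ^ p)
        ((1 ^ p + (- \<i>) ^ p) * ((z ^ k) ^ p + \<i> ^ p)) (of_nat p)"
      by (rule alg_int_cong_mult)
    moreover have "(z ^ k) ^ p = 1" using assms(3) by (metis power_commutes power_mult mult.commute power_one)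
    \<comment> \<open>As \<open>p\<close> is odd, \<open>(- \<i>) ^ p\<close> is minus
      \<open>\<i> ^ p\<close>, and the product is 1 minus the square of \<open>\<i> ^ p\<close>,
      which is -1.\<close>
    moreover have "(1 ^ p + (- \<i>) ^ p) * (1 + \<i> ^ p) = 2"
    proof -
      have "\<i> ^ p * \<i> ^ p = (\<i> * \<i>) ^ p" by (rule power_mult_distrib[symmetric])
      also have "\<dots> = -1" using assms(2) by simp
      finally show ?thesis using assms(2) by (simp add: algebra_simps)
    qed
    ultimately show ?thesis by (simp add: power_mult_distrib)
  qed
  hence "alg_int_cong (\<Prod>k\<in>R. ((1 - \<i>) * (z ^ k + \<i>)) ^ p) (\<Prod>k\<in>R. 2) (of_nat p)"
    by (intro alg_int_cong_prod closure algebraic_int_numeral)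
  thus ?thesis by (simp add: prod_power_distrib)
qed

section \<open>The tangent factors and the evaluation of the product\<close>

text \<open>Numerator and denominator share the factor \<open>cis t\<close>. Removing it leaves
  \<open>2 * (cos t + sin t)\<close> over \<open>2 * cos t\<close>, and the hypothesis says that
  \<open>cos t\<close> is nonzero.\<close>

lemma one_plus_tan_eq:
  assumes "cis (2 * t) \<noteq> - 1"
  shows "complex_of_real (1 + tan t) = (1 - \<i>) * (cis (2 * t) + \<i>) / (1 + cis (2 * t))"
proof -
  define c s where "c = complex_of_real (cos t)" and "s = complex_of_real (sin t)"
  have cs: "c * c + s * s = 1"
    unfolding c_def s_def by (metis cos_squared_eq diff_add_cancel of_real_1 of_real_add of_real_mult power2_eq_square)
  have t: "cis t = c + \<i> * s" by (simp add: cis_conv_exp c_def s_def exp_Euler cos_of_real sin_of_real)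
  have cis2: "cis (2 * t) = (c + \<i> * s) * (c + \<i> * s)" by (simp add: cis_mult flip: t)
  \<comment> \<open>Writing 1 as \<open>cis t\<close> times its conjugate makes \<open>cis t\<close>
    factor out of both \<open>1 + cis (2 * t)\<close> and \<open>cis (2 * t) + \<i>\<close>.\<close>
  have one: "1 = (c + \<i> * s) * (c - \<i> * s)" using cs by (simp add: algebra_simps)
  have "1 + cis (2 * t) = (c + \<i> * s) * (c - \<i> * s) + (c + \<i> * s) * (c + \<i> * s)"
    using cis2 one by simp
  also have "\<dots> = (c + \<i> * s) * (2 * c)" by (simp add: algebra_simps)
  finally have den: "1 + cis (2 * t) = (c + \<i> * s) * (2 * c)" .
  have "cis (2 * t) + \<i> = (c + \<i> * s) * (c + \<i> * s) + \<i> * ((c + \<i> * s) * (c - \<i> * s))"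
    using cis2 one by simp
  also have "\<dots> = (c + \<i> * s) * ((1 + \<i>) * (c + s))" by (simp add: algebra_simps)
  finally have num: "cis (2 * t) + \<i> = (c + \<i> * s) * ((1 + \<i>) * (c + s))" .
  have "(c + \<i> * s) * (2 * c) \<noteq> 0" using assms unfolding den[symmetric]
    by (metis add.commute eq_neg_iff_add_eq_0)
  hence nz: "c + \<i> * s \<noteq> 0" "c \<noteq> 0" by auto
  have "complex_of_real (1 + tan t) = (c + s) / c"
    using nz by (simp add: tan_def c_def s_def field_simps)
  also have "\<dots> = ((1 - \<i>) * (1 + \<i>)) * (c + s) / (2 * c)" using nz by (simp add: field_simps)
  also have "\<dots> = (c + \<i> * s) * (((1 - \<i>) * (1 + \<i>)) * (c + s)) / ((c + \<i> * s) * (2 * c))"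
    by (rule mult_divide_mult_cancel_left[OF nz(1), symmetric])
  also have "\<dots> = (1 - \<i>) * (cis (2 * t) + \<i>) / (1 + cis (2 * t))"
    unfolding den num by (simp only: mult_ac)
  finally show ?thesis .
qed

lemma minus_two_power_squared: "((- 2) ^ h) ^ 2 = (2 :: 'a::comm_ring_1) ^ (2 * h)"
  by (simp add: power_mult power2_eq_square flip: power_mult_distrib)

theorem theorem1p1:
  fixes m p :: nat and a :: int
  assumes "m > 0"
    and "prime p"
    and "[p = 1] (mod 2 * m)"
    and "power_residue m p 2"
    and "\<not> [a = 0] (mod int p)"
  shows "complex_of_real
           (\<Prod>k\<in>power_residues m p. 1 + tan (pi * real_of_int a * real k / real p))
         = power_residue_symbol (2 * m) p (-2) * (-2) ^ ((p - 1) div (2 * m))"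
proof -
  define R where "R = power_residues m p"
  have p1: "p > 1" using prime_gt_1_nat[OF assms(2)] .
  have "2 * m dvd p - 1" using assms(3) p1 by (simp add: cong_altdef_nat cong_sym_eq)
  then obtain h where h: "p - 1 = 2 * m * h" by (auto elim: dvdE)
  hence "h > 0" using p1 by (auto intro!: Nat.gr0I)
  have p: "p = 2 * (m * h) + 1" using h p1 by simp
  hence "odd p" by simp
  have hdiv: "(p - 1) div (2 * m) = h" using h assms(1) by simp
  have card: "card R = 2 * h"
    unfolding R_def using card_power_residues[OF assms(2), of m "2 * h"] h by (simp add: mult_ac)

  define z where "z = cis (2 * pi * a / p)"
  have z_power: "z ^ k = cis (2 * (pi * a * k / p))" for k :: nat
    by (simp add: z_def Complex.DeMoivre mult_ac)
  have "z ^ p = cis (2 * pi * a)" using p1 by (simp add: z_power mult_ac)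
  hence "z ^ p = 1" by (simp add: cis_multiple_2pi)
  have "z \<noteq> 1"
  proof
    assume "z = 1"
    then obtain k :: int where "2 * pi * a / p = 2 * pi * k"
      by (auto simp: z_def complex_eq_iff cos_one_2pi_int mult_ac)
    hence "real_of_int a = real_of_int (k * int p)" using p1 by (simp add: field_simps)
    hence "a = k * int p" by (simp only: of_int_eq_iff)
    thus False using assms(5) by (simp add: cong_0_iff)
  qed
  have "power_residue m p (- 1)" using power_residue_minus_one[OF assms(2) h] .

  define L where "L = (\<Prod>k\<in>R. (1 - \<i>) * (z ^ k + \<i>))"
  have "complex_of_real (\<Prod>k\<in>R. 1 + tan (pi * a * k / p))
        = (\<Prod>k\<in>R. (1 - \<i>) * (z ^ k + \<i>) / (1 + z ^ k))"
    unfolding of_real_prod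
  proof (rule prod.cong[OF refl])
    fix k
    \<comment> \<open>The \<open>p\<close>-th power of the left side is 1, that of the right side is
      -1.\<close>
    have "z ^ k \<noteq> - 1"
    proof
      assume "z ^ k = - 1"
      hence "(z ^ p) ^ k = (- 1) ^ p" by (metis mult.commute power_mult)
      thus False using \<open>z ^ p = 1\<close> \<open>odd p\<close> by simp
    qed
    thus "complex_of_real (1 + tan (pi * a * k / p)) = (1 - \<i>) * (z ^ k + \<i>) / (1 + z ^ k)"
      unfolding z_power by (rule one_plus_tan_eq)
  qed
  also have "\<dots> = L"
    using prod_one_plus_root_of_unity[OF assms(2) \<open>z ^ p = 1\<close> \<open>z \<noteq> 1\<close> assms(4)]
    by (simp add: prod_dividef L_def R_def)
  finally have prod_eq: "complex_of_real (\<Prod>k\<in>R. 1 + tan (pi * a * k / p)) = L" .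

  have "L = (1 - \<i>) ^ card R * (\<Prod>k\<in>R. z ^ k + \<i>)" by (simp add: L_def prod.distrib)
  hence "L ^ 2 = ((1 - \<i>) ^ card R) ^ 2 * \<i> ^ card R"
    using prod_root_of_unity_plus_ii_squared[OF assms(2) \<open>odd p\<close> \<open>z ^ p = 1\<close> \<open>z \<noteq> 1\<close> assms(4)
            \<open>power_residue m p (- 1)\<close>]
    by (simp add: power_mult_distrib R_def)
  also have "\<dots> = ((1 - \<i>) ^ 2 * \<i>) ^ card R"
    by (simp add: power_mult_distrib mult.commute flip: power_mult)
  also have "(1 - \<i>) ^ 2 * \<i> = 2" by (simp add: power2_eq_square algebra_simps)
  \<comment> \<open>The number of residues is even, so \<open>(- 2) ^ h\<close> serves as a square
    root; this one is chosen because it is also the power in the residue symbol.\<close>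
  also have "(2::complex) ^ card R = ((- 2) ^ h) ^ 2"
    by (simp only: card minus_two_power_squared)
  finally have "L = (- 2) ^ h \<or> L = - ((- 2) ^ h)" by (simp add: power2_eq_iff)
  then obtain s :: int where s: "s = 1 \<or> s = -1" and L: "L = of_int (s * (- 2) ^ h)"
  proof
    assume "L = (- 2) ^ h"
    thus ?thesis using that[of 1] by simp
  next
    assume "L = - ((- 2) ^ h)"
    thus ?thesis using that[of "-1"] by simp
  qed
  define t where "t = s * (- 2) ^ h"
  have "s * s = 1" using s by auto

  \<comment> \<open>Here \<open>2 * h\<close> is the quotient of \<open>p - 1\<close> by
    \<open>m\<close>, and 2 is an \<open>m\<close>-th power residue.\<close>
  have two: "[2 ^ (2 * h) = 1] (mod int p)"
    using power_residue_power_eq_1[OF assms(2) _ assms(4), of "2 * h"] h by (simp add: mult_ac)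
  have "alg_int_cong (of_int (t ^ p)) (of_int (2 ^ (2 * h))) (of_nat p)"
    using prod_root_of_unity_plus_ii_cong[OF assms(2) \<open>odd p\<close> \<open>z ^ p = 1\<close>, of R] L
    by (simp add: L_def[symmetric] card t_def)
  hence "[t ^ p = 2 ^ (2 * h)] (mod int p)"
    using p1 by (subst (asm) alg_int_cong_of_int_iff) auto
  hence tp: "[t ^ p = 1] (mod int p)" using two by (rule cong_trans)
  \<comment> \<open>Since \<open>p = 2 * (m * h) + 1\<close> and \<open>t ^ 2\<close> is 1 modulo
    \<open>p\<close>, the power \<open>t ^ p\<close> reduces to \<open>t\<close>.\<close>
  have "t ^ 2 = (s * s) * ((- 2) ^ h) ^ 2"
    unfolding t_def power_mult_distrib by (simp only: power2_eq_square)
  also have "\<dots> = 2 ^ (2 * h)" by (simp only: \<open>s * s = 1\<close> minus_two_power_squared mult_1)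
  finally have "[(t ^ 2) ^ (m * h) = 1 ^ (m * h)] (mod int p)"
    using two by (intro cong_pow) simp
  hence "[(t ^ 2) ^ (m * h) * t = 1 * t] (mod int p)" by (intro cong_mult cong_refl) simp
  moreover have "t ^ p = (t ^ 2) ^ (m * h) * t" using p by (simp add: power_mult[symmetric] flip: power_Suc2)
  ultimately have "[t = 1] (mod int p)" using tp by (metis cong_sym cong_trans mult_1)
  \<comment> \<open>Multiplying by the sign \<open>s\<close> isolates
    \<open>(- 2) ^ h\<close>.\<close>
  hence "[s * t = s * 1] (mod int p)" by (intro cong_mult cong_refl)
  moreover have "s * t = (- 2) ^ h" using \<open>s * s = 1\<close> by (simp add: t_def flip: mult.assoc)
  ultimately have "[(- 2) ^ h = s] (mod int p)" by simp
  moreover have "2 * m < p"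
  proof -
    have "2 * m * 1 \<le> p - 1" unfolding h using \<open>h > 0\<close> by (intro mult_le_mono2) simp
    thus ?thesis using p1 by linarith
  qed
  moreover have "s ^ (2 * m) = 1" using s by auto
  ultimately have "power_residue_symbol (2 * m) p (- 2) = of_int s"
    using assms(1) s hdiv by (intro power_residue_symbol_eq_of_int) simp_all
  thus ?thesis using prod_eq L hdiv by (simp add: R_def)
qed

end
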